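(* Let $q=2^m$ and let $g(x)\in K[x]$ be a polynomial with $g(u)\in F\setminus\{0\}$ for all $u\in S$. Let $H=\{u/g(u): u\in S\}\cup\{0\}$ and let $$\mathscr{M}=\{(i,k): 1\le k\le q-2,\ 0\le i\le \lfloor (k-1)/2\rfloor,\ i\preceq k\}.$$ Then the following are equivalent: (a) $H$ is a hyperoval; (b) for each $(i,k)\in\mathscr{M}$, the coefficient of $x^{2i-k+q+1}$ in $g(x)^{q-1-k}\bmod (x^{q+1}-1)$ is zero; (c) for each $(i,k)\in\mathscr{M}$, the coefficient of $x^{k-2i}$ in $g(x)^{q-1-k}\bmod (x^{q+1}-1)$ is zero. Here $f(x)\bmod (x^{q+1}-1)$ denotes the remainder of $f$ upon division by $x^{q+1}-1$ (a polynomial of degree at most $q$).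
   Context: Let $q=2^m$, $F=\mathbb{F}_q$, $K=\mathbb{F}_{q^2}$, and for $x\in K$ write $\bar x=x^q$. Let $S=\{u\in K: u^{q+1}=1\}$ and define the $F$-valued bilinear form $\langle x,y\rangle=x\bar y+\bar x y$ on $K$. The affine plane $AG(2,q)$ is identified with $K$: its points are the elements of $K$ and its lines are the sets $L(u,\mu)=\{x\in K:\langle u,x\rangle+\mu=0\}$ with $u\in S$, $\mu\in F$. A hyperoval is a set of $q+2$ points of $K$, no three of which lie on a common line. For nonnegative integers $b=\sum_j b_j2^j$, $c=\sum_j c_j2^j$ with $b_j,c_j\in\{0,1\}$, write $b\preceq c$ if $b_j\le c_j$ for all $j$. *)

theory Defs
  imports
    "HOL-Library.Cardinality"
    "HOL-Computational_Algebra.Computational_Algebra"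
begin

text \<open>
  The field \<open>K\<close> with \<open>q\<^sup>2\<close> elements is the whole type \<open>'a\<close>; the field \<open>F\<close> with \<open>q\<close> elements is
  a subset of \<open>'a\<close> that is a subfield. Such a subfield is unique, so quantifying over it is
  the same as fixing it.
\<close>

definition is_subfield :: "'a::field set \<Rightarrow> bool" where
  "is_subfield F \<longleftrightarrow> 0 \<in> F \<and> 1 \<in> F \<and>
     (\<forall>x\<in>F. \<forall>y\<in>F. x + y \<in> F \<and> x * y \<in> F) \<and>
     (\<forall>x\<in>F. - x \<in> F \<and> inverse x \<in> F)"

definition conj_q :: "nat \<Rightarrow> 'a::field \<Rightarrow> 'a" where
  "conj_q q x = x ^ q"

definition unit_circle :: "nat \<Rightarrow> 'a::field set" where
  "unit_circle q = {u. u ^ (q + 1) = 1}"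

definition bform :: "nat \<Rightarrow> 'a::field \<Rightarrow> 'a \<Rightarrow> 'a" where
  "bform q x y = x * conj_q q y + conj_q q x * y"

definition line :: "nat \<Rightarrow> 'a::field \<Rightarrow> 'a \<Rightarrow> 'a set" where
  "line q u \<mu> = {x. bform q u x + \<mu> = 0}"

definition lines :: "nat \<Rightarrow> 'a::field set \<Rightarrow> 'a set set" where
  "lines q F = {line q u \<mu> | u \<mu>. u \<in> unit_circle q \<and> \<mu> \<in> F}"

definition hyperoval :: "nat \<Rightarrow> 'a::field set \<Rightarrow> 'a set \<Rightarrow> bool" where
  "hyperoval q F H \<longleftrightarrow> finite H \<and> card H = q + 2 \<and>
     (\<forall>x\<in>H. \<forall>y\<in>H. \<forall>z\<in>H. x \<noteq> y \<and> y \<noteq> z \<and> x \<noteq> z \<longrightarrow>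
        \<not> (\<exists>l\<in>lines q F. x \<in> l \<and> y \<in> l \<and> z \<in> l))"

definition bin_le :: "nat \<Rightarrow> nat \<Rightarrow> bool" (infix \<open>\<preceq>\<close> 50) where
  "b \<preceq> c \<longleftrightarrow> (\<forall>j. bit b j \<longrightarrow> bit c j)"

definition index_set :: "nat \<Rightarrow> (nat \<times> nat) set" where
  "index_set q = {(i, k). 1 \<le> k \<and> k \<le> q - 2 \<and> i \<le> (k - 1) div 2 \<and> i \<preceq> k}"

definition point_set :: "nat \<Rightarrow> 'a::field poly \<Rightarrow> 'a set" where
  "point_set q g = {u / poly g u | u. u \<in> unit_circle q} \<union> {0}"

definition reduced_power :: "nat \<Rightarrow> 'a::field poly \<Rightarrow> nat \<Rightarrow> 'a poly" where
  "reduced_power q g n = g ^ n mod (monom 1 (q + 1) - 1)"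

end

theory Submission
  imports Defs
begin

text \<open>
  Since \<open>H\<close> has \<open>q + 2\<close> points and every point lies on \<open>q + 1\<close> lines, \<open>H\<close> is a hyperoval iff every
  line meets it in an even number of points. As \<open>y\<^sup>q\<^sup>-\<^sup>1\<close> is the indicator of \<open>y \<noteq> 0\<close> on \<open>F\<close>, the
  parity of \<open>H \<inter> L(w,\<mu>)\<close> is \<open>\<Sum>x\<in>H. (\<langle>w,x\<rangle> + \<mu>)\<^sup>q\<^sup>-\<^sup>1\<close>, a polynomial in \<open>\<mu>\<close> whose coefficients are
  the power sums \<open>\<Sum>x\<in>H. \<langle>w,x\<rangle>\<^sup>k\<close>. Expanding \<open>\<langle>w,x\<rangle>\<^sup>k = (w x\<^sup>q + w\<^sup>q x)\<^sup>k\<close> modulo 2 by Lucas' theorem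
  and using orthogonality of the characters of \<open>S\<close>, the vanishing of these sums for all \<open>w \<in> S\<close> is
  equivalent to the vanishing of the sums \<open>\<Sum>u\<in>S. u\<^sup>2\<^sup>i\<^sup>-\<^sup>k g(u)\<^sup>q\<^sup>-\<^sup>1\<^sup>-\<^sup>k\<close> with \<open>i \<preceq> k\<close>, which are
  coefficients of \<open>g\<^sup>q\<^sup>-\<^sup>1\<^sup>-\<^sup>k mod (x\<^sup>q\<^sup>+\<^sup>1 - 1)\<close>. The conjugation \<open>i \<mapsto> k - i\<close> halves the index range.
\<close>

section \<open>Binomial coefficients modulo 2\<close>

lemma bin_le_rec: "k \<preceq> n \<longleftrightarrow> (odd k \<longrightarrow> odd n) \<and> k div 2 \<preceq> n div 2"
proof
  assume "k \<preceq> n"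
  then show "(odd k \<longrightarrow> odd n) \<and> k div 2 \<preceq> n div 2"
    unfolding bin_le_def by (metis bit_0 bit_Suc)
next
  assume *: "(odd k \<longrightarrow> odd n) \<and> k div 2 \<preceq> n div 2"
  show "k \<preceq> n"
    unfolding bin_le_def
  proof
    fix j show "bit k j \<longrightarrow> bit n j"
      using * unfolding bin_le_def by (cases j) (auto simp: bit_0 bit_Suc)
  qed
qed

text \<open>Coefficientwise, this is (1 + x)^(2n) = (1 + x^2)^n modulo 2. Pascal's rule applied
  twice yields a doubled middle term, which drops out.\<close>

lemma parity_double_choose:
  "odd ((2 * n) choose (2 * k)) \<longleftrightarrow> odd (n choose k)"
  "even ((2 * n) choose (2 * k + 1))"
proof (induction n arbitrary: k)
  case 0
  { case 1 show ?case by (cases k) auto }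
  { case 2 show ?case by auto }
next
  case (Suc n)
  have step: "(2 * Suc n) choose (Suc (Suc j)) =
      (2 * n choose j) + 2 * (2 * n choose Suc j) + (2 * n choose Suc (Suc j))" for j
    by simp
  { case 1 show ?case
    proof (cases k)
      case (Suc l)
      have "(2 * Suc n) choose (2 * k) =
          (2 * n choose (2 * l)) + 2 * (2 * n choose Suc (2 * l)) + (2 * n choose (2 * Suc l))"
        using step[of "2 * l"] Suc by simp
      then show ?thesis using Suc Suc.IH(1)[of l] Suc.IH(1)[of "Suc l"] by auto
    qed simp }
  { case 2 show ?case
    proof (cases k)
      case (Suc l)
      have "(2 * Suc n) choose (2 * k + 1) =
          (2 * n choose (2 * l + 1)) + 2 * (2 * n choose (2 * l + 2)) + (2 * n choose (2 * Suc l + 1))"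
        using step[of "2 * l + 1"] Suc by simp
      then show ?thesis using Suc.IH(2)[of l] Suc.IH(2)[of "Suc l"] by simp
    qed simp }
qed

lemma odd_choose_rec:
  "odd (n choose k) \<longleftrightarrow> (odd k \<longrightarrow> odd n) \<and> odd ((n div 2) choose (k div 2))"
proof -
  define a b where "a = n div 2" and "b = k div 2"
  have n: "n = 2 * a \<or> n = Suc (2 * a)" and k: "k = 2 * b \<or> k = Suc (2 * b)"
    unfolding a_def b_def by presburger+
  have odd_even: "odd (Suc (2 * a) choose (2 * b)) \<longleftrightarrow> odd (2 * a choose (2 * b))"
  proof (cases b)
    case (Suc c)
    then show ?thesis using parity_double_choose(2)[of a c] by simp
  qed simp
  show ?thesis
    using n k odd_even parity_double_choose[of a b] unfolding a_def[symmetric] b_def[symmetric]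
    by auto
qed

text \<open>Lucas' theorem for the prime 2, by stripping the lowest binary digit of both
  arguments.\<close>

lemma odd_choose_iff_bin_le: "odd (n choose k) \<longleftrightarrow> k \<preceq> n"
proof (induction n arbitrary: k rule: less_induct)
  case (less n)
  show ?case
  proof (cases "n = 0")
    case True
    then show ?thesis
      by (cases k) (auto simp: bin_le_def, metis bit_eq_iff bit_0_eq bot_apply nat.distinct(1) bot_bool_def)
  next
    case False
    then show ?thesis using less[of "n div 2"] odd_choose_rec[of n k] bin_le_rec[of k n] by simp
  qed
qed

lemma bin_le_imp_le: "i \<preceq> k \<Longrightarrow> i \<le> k"
  using odd_choose_iff_bin_le[of k i] by (metis binomial_eq_0 even_zero not_le)

lemma bin_le_diff: "i \<preceq> k \<Longrightarrow> k - i \<preceq> k"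
  by (metis bin_le_imp_le binomial_symmetric odd_choose_iff_bin_le)

text \<open>For odd \<open>i\<close> the lowest digit already fails; for even \<open>i\<close> both
  sides are halved. This excludes a fixed point of the reflection sending i to k - i.\<close>

lemma not_bin_le_double: "i > 0 \<Longrightarrow> \<not> i \<preceq> 2 * i"
proof (induction i rule: less_induct)
  case (less i)
  then show ?case
    using bin_le_rec[of i "2 * i"] less.IH[of "i div 2"]
    by (cases "odd i") (auto elim!: evenE)
qed

lemma bin_le_mask: "k < 2 ^ m \<Longrightarrow> k \<preceq> 2 ^ m - 1"
  unfolding bin_le_def mask_eq_exp_minus_1[symmetric] bit_mask_iff
  by (metis bit_take_bit_iff possible_bit_nat take_bit_nat_eq_self)

section \<open>The quadratic extension of \<open>F\<close>\<close>

locale quadratic_extension =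
  fixes m q :: nat and F :: "'a::finite_field set"
  assumes q_eq: "q = 2 ^ m"
    and card_K: "CARD('a) = q ^ 2"
    and subfield: "is_subfield F"
    and card_F: "card F = q"
begin

abbreviation S :: "'a set" where "S \<equiv> unit_circle q"

text \<open>The exponent \<open>m = 0\<close> would give a field with one element.\<close>

lemma q_ge_2: "q \<ge> 2"
proof (rule ccontr)
  assume "\<not> q \<ge> 2"
  then have "q \<le> 1" by simp
  then have "CARD('a) \<le> 1" using card_K power_mono[of q 1 2] by simp
  moreover have "card {0, 1 :: 'a} \<le> CARD('a)" by (rule card_mono) auto
  ultimately show False by simp
qed

lemma even_q: "even q"
  using q_ge_2 q_eq by (cases m) auto

text \<open>Raising -1 to the even power \<open>CARD('a)\<close> gives 1, yet must give -1
  back.\<close>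

lemma two_eq_0: "(2 :: 'a) = 0"
proof -
  have "even (CARD('a))" using even_q card_K by simp
  then have "(-1 :: 'a) = 1" using finite_field_power_card_eq_same[of "-1 :: 'a"] by simp
  then show ?thesis by (metis one_add_one add.left_inverse)
qed

lemma char_2: "CHAR('a) = 2"
proof -
  have "of_nat 2 = (0 :: 'a)" using two_eq_0 by simp
  then have "CHAR('a) dvd 2" by (simp only: of_nat_eq_0_iff_char_dvd)
  then show ?thesis using CHAR_prime[where ?'a = 'a] by (metis primes_dvd_imp_eq two_is_prime_nat)
qed

lemma of_nat_eq_0_iff_even: "of_nat n = (0 :: 'a) \<longleftrightarrow> even n"
  by (simp add: of_nat_eq_0_iff_char_dvd char_2)

lemma of_nat_odd: "odd n \<Longrightarrow> of_nat n = (1 :: 'a)"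
  by (auto elim!: oddE simp: two_eq_0)

lemma add_self: "x + x = (0 :: 'a)"
  by (metis mult_2 mult_zero_left two_eq_0)

lemma add_eq_0_iff_eq: "x + y = (0 :: 'a) \<longleftrightarrow> x = y"
  by (metis add_self add_left_cancel)

lemma square_inject: "x ^ 2 = y ^ 2 \<longleftrightarrow> x = (y :: 'a)"
  by (metis add_eq_0_iff_eq add.right_inverse power2_eq_iff)

lemma add_power_q: "(x + y :: 'a) ^ q = x ^ q + y ^ q"
  by (rule freshmans_dream'[of q m]) (simp_all add: char_2 q_eq)

lemma sum_power_q: "(\<Sum>x\<in>A. f x :: 'a) ^ q = (\<Sum>x\<in>A. f x ^ q)"
  by (rule freshmans_dream_sum'[of q m]) (simp_all add: char_2 q_eq)

lemma power_q_q: "((x :: 'a) ^ q) ^ q = x"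
  using finite_field_power_card_eq_same[of x] card_K by (simp add: power2_eq_square power_mult)

lemma F_closed:
  "0 \<in> F" "1 \<in> F" "x \<in> F \<Longrightarrow> y \<in> F \<Longrightarrow> x + y \<in> F" "x \<in> F \<Longrightarrow> y \<in> F \<Longrightarrow> x * y \<in> F"
  "x \<in> F \<Longrightarrow> inverse x \<in> F"
  using subfield unfolding is_subfield_def by auto

text \<open>Multiplication by a nonzero \<open>x\<close> permutes \<open>F - {0}\<close>, so the
  product of all its elements is unchanged by a factor x^(q-1).\<close>

lemma F_power_q:
  assumes "x \<in> F"
  shows "x ^ q = x"
proof (cases "x = 0")
  case False
  have "x * (\<Prod>y\<in>F-{0}. x * y) = x * x ^ (q - 1) * \<Prod>(F-{0})"
    by (simp add: prod.distrib mult_ac card_F F_closed)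
  also have "x * x ^ (q - 1) = x ^ q"
    using q_ge_2 by (metis One_nat_def Suc_pred power_Suc less_le_trans pos2)
  also have "(\<Prod>y\<in>F-{0}. x * y) = (\<Prod>y\<in>F-{0}. y)"
    by (rule prod.reindex_bij_witness[of _ "\<lambda>y. inverse x * y" "\<lambda>y. x * y"])
      (use False assms in \<open>auto simp: F_closed\<close>)
  finally show ?thesis by simp
qed (use q_ge_2 in simp)

text \<open>The polynomial x^q - x has at most \<open>q\<close> roots, and \<open>F\<close> already
  supplies \<open>q\<close> of them.\<close>

lemma F_iff: "x \<in> F \<longleftrightarrow> x ^ q = x"
proof -
  define p :: "'a poly" where "p = monom 1 q - monom 1 1"
  have "coeff p q = 1" using q_ge_2 unfolding p_def by simp
  then have "p \<noteq> 0" by auto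
  have "degree p \<le> q"
    unfolding p_def using q_ge_2 by (intro degree_diff_le degree_monom_le[THEN order_trans]) auto
  have "{x. x ^ q = x} = {x. poly p x = 0}" unfolding p_def by (simp add: poly_monom)
  then have "card {x :: 'a. x ^ q = x} \<le> q"
    using card_poly_roots_bound[OF \<open>p \<noteq> 0\<close>] \<open>degree p \<le> q\<close> by simp
  then have "F = {x. x ^ q = x}"
    by (intro card_seteq) (auto simp: F_power_q card_F)
  then show ?thesis by blast
qed

lemma F_power_pred: "x \<in> F \<Longrightarrow> x \<noteq> 0 \<Longrightarrow> x ^ (q - 1) = 1"
  using F_power_q[of x] q_ge_2 by (cases q) auto

section \<open>The norm-one group and its character sums\<close>

lemma S_iff: "u \<in> S \<longleftrightarrow> u ^ (q + 1) = 1"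
  by (simp add: unit_circle_def)

lemma S_nonzero: "u \<in> S \<Longrightarrow> u \<noteq> 0"
  by (auto simp: S_iff)

text \<open>Root counting gives the upper bound. For the lower bound, x^(q-1) maps the q^2 - 1
  nonzero elements into \<open>S\<close> with fibres of size at most q - 1.\<close>

lemma card_S: "card S = q + 1"
proof (rule antisym)
  define p :: "'a poly" where "p = monom 1 (q + 1) - 1"
  have "coeff p (q + 1) = 1" unfolding p_def by simp
  then have "p \<noteq> 0" by auto
  have "degree p \<le> q + 1"
    unfolding p_def by (intro degree_diff_le degree_monom_le) auto
  have "S = {x. poly p x = 0}" unfolding p_def S_iff set_eq_iff by (simp add: poly_monom)
  then show "card S \<le> q + 1"
    using card_poly_roots_bound[OF \<open>p \<noteq> 0\<close>] \<open>degree p \<le> q + 1\<close> by simp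
next
  define h where "h = (\<lambda>x :: 'a. x ^ (q - 1))"
  have sq: "(q - 1) * (q + 1) = q\<^sup>2 - 1"
    by (simp add: algebra_simps power2_eq_square)
  have pow: "x ^ (q\<^sup>2 - 1) = 1" if "x \<noteq> 0" for x :: 'a
  proof -
    have "x * x ^ (q\<^sup>2 - 1) = x ^ q\<^sup>2"
      using q_ge_2 by (metis One_nat_def Suc_pred power_Suc less_le_trans pos2 zero_less_power)
    also have "\<dots> = x" using finite_field_power_card_eq_same[of x] card_K by simp
    finally show ?thesis using that by simp
  qed
  have im: "h ` (UNIV - {0}) \<subseteq> S"
    unfolding h_def image_subset_iff S_iff power_mult[symmetric] sq using pow by blast
  have fibre: "card {x \<in> UNIV - {0}. h x = s} \<le> q - 1" for s
  proof -
    define p :: "'a poly" where "p = monom 1 (q - 1) - [:s:]"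
    have "coeff p (q - 1) = 1" unfolding p_def using q_ge_2 by (cases "q - 1") auto
    then have "p \<noteq> 0" by auto
    have "card {x \<in> UNIV - {0}. h x = s} \<le> card {x. poly p x = 0}"
      by (rule card_mono) (auto simp: p_def h_def poly_monom)
    also have "\<dots> \<le> degree p" by (rule card_poly_roots_bound[OF \<open>p \<noteq> 0\<close>])
    also have "\<dots> \<le> q - 1" unfolding p_def by (intro degree_diff_le degree_monom_le) auto
    finally show ?thesis .
  qed
  have "q\<^sup>2 - 1 = card (UNIV - {0 :: 'a})" using card_K by simp
  also have "UNIV - {0} = (\<Union>s\<in>S. {x \<in> UNIV - {0}. h x = s})" using im by auto
  also have "card \<dots> \<le> (\<Sum>s\<in>S. card {x \<in> UNIV - {0}. h x = s})" by (rule card_UN_le) simp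
  also have "\<dots> \<le> (\<Sum>s\<in>S. q - 1)" by (rule sum_mono) (rule fibre)
  finally have "(q - 1) * (q + 1) \<le> (q - 1) * card S" unfolding sq by (simp add: mult.commute)
  then show "q + 1 \<le> card S" unfolding mult_le_cancel1 using q_ge_2 by linarith
qed

lemma S_mult: "u \<in> S \<Longrightarrow> v \<in> S \<Longrightarrow> u * v \<in> S"
  by (simp add: S_iff power_mult_distrib del: power_Suc)

lemma S_divide: "u \<in> S \<Longrightarrow> v \<in> S \<Longrightarrow> u / v \<in> S"
  by (simp add: S_iff power_divide del: power_Suc)

lemma S_power_multiple: "u \<in> S \<Longrightarrow> (q + 1) dvd j \<Longrightarrow> u ^ j = 1"
  unfolding S_iff by (metis dvdE power_mult power_one)

lemma S_power_mod: "u \<in> S \<Longrightarrow> u ^ (j mod (q + 1)) = u ^ j"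
  by (metis S_power_multiple dvd_triv_left mult.left_neutral mult_div_mod_eq power_add)

text \<open>Orthogonality of characters: translating by some \<open>w\<close> with w^j different
  from 1 multiplies the sum by w^j, so it vanishes. The trivial character gives q + 1, which is 1 in
  characteristic 2.\<close>

lemma sum_S_power: "(\<Sum>u\<in>S. u ^ j) = (if (q + 1) dvd j then 1 else 0)"
proof (cases "(q + 1) dvd j")
  case True
  then have "(\<Sum>u\<in>S. u ^ j) = of_nat (card S)" by (simp add: S_power_multiple)
  then show ?thesis using True card_S even_q of_nat_odd[of "q + 1"] by simp
next
  case False
  define r where "r = j mod (q + 1)"
  have r: "0 < r" "r \<le> q" using False unfolding r_def by (auto simp: mod_greater_zero_iff_not_dvd less_Suc_eq_le)
  \<comment> \<open>Otherwise x^r, of degree at most \<open>q\<close>, would agree with the constant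
    1 at q + 1 points.\<close>
  have "\<exists>w\<in>S. w ^ r \<noteq> 1"
  proof (rule ccontr)
    assume "\<not> ?thesis"
    then have "monom (1 :: 'a) r = 1"
      by (intro poly_eqI_degree[of S]) (use r card_S in \<open>auto simp: poly_monom degree_monom_eq\<close>)
    then show False using r by (metis degree_1 degree_monom_eq less_irrefl one_neq_zero)
  qed
  then obtain w where w: "w \<in> S" "w ^ j \<noteq> 1" unfolding r_def by (metis S_power_mod)
  have "(\<Sum>u\<in>S. u ^ j) = (\<Sum>u\<in>S. (w * u) ^ j)"
    by (rule sum.reindex_bij_witness[of _ "\<lambda>u. w * u" "\<lambda>u. u / w"])
      (use w S_nonzero in \<open>auto intro: S_mult S_divide\<close>)
  also have "\<dots> = w ^ j * (\<Sum>u\<in>S. u ^ j)" by (simp add: power_mult_distrib sum_distrib_left)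
  finally show ?thesis using w False by (metis mult_cancel_right1)
qed

section \<open>Hyperovals and parity of line intersections\<close>

lemma bform_eq: "bform q x y = x * y ^ q + x ^ q * y"
  by (simp add: bform_def conj_q_def)

lemma bform_in_F: "bform q x y \<in> F"
  by (simp add: F_iff bform_eq add_power_q power_mult_distrib power_q_q add.commute)

lemma bform_add_right: "bform q w (x + y :: 'a) = bform q w x + bform q w y"
  by (simp add: bform_eq add_power_q algebra_simps)

lemma bform_add_eq_0_iff: "bform q w (x + y :: 'a) = 0 \<longleftrightarrow> bform q w x = bform q w y"
  by (simp add: bform_add_right add_eq_0_iff_eq)

lemma mem_line_iff: "(x :: 'a) \<in> line q w \<mu> \<longleftrightarrow> bform q w x = \<mu>"
  by (simp add: line_def add_eq_0_iff_eq)

lemma bform_eq_0_iff: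
  assumes "w \<in> S" "z \<noteq> 0"
  shows "bform q w z = 0 \<longleftrightarrow> w\<^sup>2 = z / z ^ q"
proof -
  have w: "w \<noteq> 0" "w ^ q * w = 1" using assms S_nonzero by (auto simp: S_iff mult.commute)
  have "bform q w z = 0 \<longleftrightarrow> w * bform q w z = 0" using w by simp
  also have "w * bform q w z = w\<^sup>2 * z ^ q + (w ^ q * w) * z"
    by (simp add: bform_eq algebra_simps power2_eq_square)
  also have "\<dots> = w\<^sup>2 * z ^ q + z" using w by simp
  also have "\<dots> = 0 \<longleftrightarrow> w\<^sup>2 = z / z ^ q" using assms by (auto simp: add_eq_0_iff_eq field_simps)
  finally show ?thesis .
qed

text \<open>Each nonzero vector is parallel to exactly one of the q + 1 parallel classes of lines:
  the condition prescribes the square of \<open>w\<close>, and squaring is injective in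
  characteristic 2.\<close>

lemma ex1_direction:
  assumes "z \<noteq> 0"
  shows "\<exists>!w. w \<in> S \<and> bform q w z = 0"
proof -
  \<comment> \<open>The square root of a is a^(q^2/2), because a^(q^2) = a.\<close>
  define w where "w = (z / z ^ q) ^ (q\<^sup>2 div 2)"
  have "w\<^sup>2 = (z / z ^ q) ^ q\<^sup>2"
    unfolding w_def power_mult[symmetric] using even_q by simp
  then have w: "w\<^sup>2 = z / z ^ q"
    using finite_field_power_card_eq_same[of "z / z ^ q"] card_K by simp
  have "(w ^ (q + 1))\<^sup>2 = (w\<^sup>2) ^ (q + 1)" by (simp only: power_mult[symmetric] mult.commute)
  also have "\<dots> = 1"
    unfolding w using assms by (simp add: power_divide power_q_q)
  finally have "w ^ (q + 1) = 1" using square_inject[of "w ^ (q + 1)" 1] by simp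
  then have "w \<in> S" by (simp add: S_iff)
  then show ?thesis using w assms bform_eq_0_iff square_inject by metis
qed

text \<open>For distinct points x and P, \<open>direction (x + P)\<close> is the parallel class of
  the line joining them; the sum is a difference in characteristic 2.\<close>

definition direction :: "'a \<Rightarrow> 'a" where
  "direction z = (THE w. w \<in> S \<and> bform q w z = 0)"

lemma direction_eq_iff: "z \<noteq> 0 \<Longrightarrow> w \<in> S \<Longrightarrow> direction z = w \<longleftrightarrow> bform q w z = 0"
  unfolding direction_def using theI'[OF ex1_direction[of z]] ex1_direction[of z] by auto

lemma direction_in_S: "z \<noteq> 0 \<Longrightarrow> direction z \<in> S"
  unfolding direction_def using theI'[OF ex1_direction[of z]] by auto

text \<open>For P in \<open>H\<close>, joining P to the other q + 1 points defines a map into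
  \<open>S\<close>, which has the same size, so it is injective iff it is surjective. Injectivity
  says that no line through P holds two further points of \<open>H\<close>, surjectivity that every
  line through P holds at least one.\<close>

lemma hyperoval_iff_even:
  assumes card_H: "card H = q + 2"
  shows "hyperoval q F H \<longleftrightarrow> (\<forall>w\<in>S. \<forall>\<mu>\<in>F. even (card {x \<in> H. bform q w x = \<mu>}))"
    (is "_ \<longleftrightarrow> ?even")
proof -
  have dir: "direction (x + P) = w \<longleftrightarrow> bform q w x = bform q w P"
    if "x \<in> H - {P}" "w \<in> S" for x P w
    using that direction_eq_iff[of "x + P" w] by (simp add: add_eq_0_iff_eq bform_add_eq_0_iff)
  have dir_S: "(\<lambda>x. direction (x + P)) ` (H - {P}) \<subseteq> S" for P
    by (auto simp: add_eq_0_iff_eq intro!: direction_in_S)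
  have card_S': "card (H - {P}) = card S" if "P \<in> H" for P
    using that card_H card_S by simp
  show ?thesis
  proof
    assume hyp: "hyperoval q F H"
    show ?even
    proof (intro ballI)
      fix w \<mu> assume w: "w \<in> S" and \<mu>: "\<mu> \<in> F"
      define A where "A = {x \<in> H. bform q w x = \<mu>}"
      show "even (card {x \<in> H. bform q w x = \<mu>})"
      proof (cases "A = {}")
        case True
        then show ?thesis unfolding A_def by (metis card.empty even_zero)
      next
        case False
        then obtain P where P: "P \<in> H" "bform q w P = \<mu>" unfolding A_def by auto
        have inj: "inj_on (\<lambda>x. direction (x + P)) (H - {P})"
        proof (rule inj_onI, rule ccontr)
          fix x y assume x: "x \<in> H - {P}" and y: "y \<in> H - {P}"
            and eq: "direction (x + P) = direction (y + P)" and "x \<noteq> y"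
          define v where "v = direction (x + P)"
          have v: "v \<in> S" using x dir_S unfolding v_def by blast
          define l where "l = line q v (bform q v P)"
          have "bform q v x = bform q v P" "bform q v y = bform q v P"
            using dir[OF x v] dir[OF y v] eq unfolding v_def by auto
          then have "x \<in> l" "y \<in> l" "P \<in> l" unfolding l_def by (simp_all add: mem_line_iff)
          moreover have "l \<in> lines q F"
            unfolding l_def lines_def using v bform_in_F by blast
          ultimately show False
            using hyp x y \<open>x \<noteq> y\<close> P(1) unfolding hyperoval_def by blast
        qed
        have "(\<lambda>x. direction (x + P)) ` (H - {P}) = S"
          using inj dir_S card_S'[OF P(1)] by (intro card_subset_eq) (auto simp: card_image)
        then have "w \<in> (\<lambda>x. direction (x + P)) ` (H - {P})" using w by simp
        then obtain Q where Q: "Q \<in> H - {P}" "direction (Q + P) = w" by blast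
        have "A = {P, Q}"
        proof
          show "{P, Q} \<subseteq> A" using P Q dir[OF Q(1) w] unfolding A_def by auto
          show "A \<subseteq> {P, Q}"
          proof
            fix x assume x: "x \<in> A"
            show "x \<in> {P, Q}"
            proof (cases "x = P")
              case False
              then have "x \<in> H - {P}" "direction (x + P) = w"
                using x dir[of x P w] w P unfolding A_def by auto
              then show ?thesis using inj Q by (auto dest: inj_onD)
            qed simp
          qed
        qed
        moreover have "P \<noteq> Q" using Q by auto
        ultimately show ?thesis unfolding A_def[symmetric] by simp
      qed
    qed
  next
    assume even: ?even
    have not_collinear: False
      if P: "P \<in> H" and x: "x \<in> H - {P}" and y: "y \<in> H - {P}" and "x \<noteq> y"
        and w: "w \<in> S" and eqs: "bform q w x = bform q w P" "bform q w y = bform q w P"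
      for P x y w
    proof -
      \<comment> \<open>An even intersection containing P must contain a second point, so every
        direction occurs.\<close>
      have "S \<subseteq> (\<lambda>x. direction (x + P)) ` (H - {P})"
      proof
        fix v assume v: "v \<in> S"
        define A where "A = {x \<in> H. bform q v x = bform q v P}"
        have "even (card A)" using even v bform_in_F unfolding A_def by blast
        then have "A \<noteq> {P}" by auto
        moreover have "P \<in> A" using P unfolding A_def by simp
        ultimately obtain Q where "Q \<in> A" "Q \<noteq> P" by blast
        then have "Q \<in> H - {P}" "direction (Q + P) = v"
          using dir[of Q P v] v unfolding A_def by auto
        then show "v \<in> (\<lambda>x. direction (x + P)) ` (H - {P})" by blast
      qed
      then have "(\<lambda>x. direction (x + P)) ` (H - {P}) = S" using dir_S by blast
      then have "inj_on (\<lambda>x. direction (x + P)) (H - {P})"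
        using card_S'[OF P] by (intro eq_card_imp_inj_on) auto
      then show False
        using dir[OF x w] dir[OF y w] eqs x y \<open>x \<noteq> y\<close> by (auto dest: inj_onD)
    qed
    show "hyperoval q F H"
      unfolding hyperoval_def
    proof (intro conjI ballI impI notI)
      fix x y z assume xyz: "x \<in> H" "y \<in> H" "z \<in> H" "x \<noteq> y \<and> y \<noteq> z \<and> x \<noteq> z"
        and "\<exists>l\<in>lines q F. x \<in> l \<and> y \<in> l \<and> z \<in> l"
      then obtain w \<mu> where "w \<in> S" "bform q w x = \<mu>" "bform q w y = \<mu>" "bform q w z = \<mu>"
        unfolding lines_def by (auto simp: mem_line_iff)
      then show False using not_collinear[of x y z w] xyz by auto
    qed (use card_H in \<open>auto intro: card_ge_0_finite\<close>)
  qed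
qed

section \<open>Parity of fibres and power sums\<close>

lemma sum_power_pred:
  assumes "finite A" "f ` A \<subseteq> F"
  shows "(\<Sum>x\<in>A. f x ^ (q - 1)) = of_nat (card {x \<in> A. f x \<noteq> 0})"
proof -
  have "f x ^ (q - 1) = (if f x \<noteq> 0 then 1 else 0)" if "x \<in> A" for x
    using that assms F_power_pred[of "f x"] q_ge_2 by auto
  then have "(\<Sum>x\<in>A. f x ^ (q - 1)) = (\<Sum>x\<in>A. if f x \<noteq> 0 then 1 else 0)"
    by (rule sum.cong[OF refl])
  also have "\<dots> = of_nat (card {x \<in> A. f x \<noteq> 0})"
    using assms(1) by (simp add: sum.If_cases Int_def conj_commute)
  finally show ?thesis .
qed

text \<open>The sum counts the points off the fibre modulo 2; as \<open>card A\<close> is even, the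
  fibre has the same parity.\<close>

lemma even_fibre_iff:
  assumes "finite A" "f ` A \<subseteq> F" "even (card A)" "\<mu> \<in> F"
  shows "even (card {x \<in> A. f x = \<mu>}) \<longleftrightarrow> (\<Sum>x\<in>A. (f x + \<mu>) ^ (q - 1)) = 0"
proof -
  have "card A = card {x \<in> A. f x = \<mu>} + card {x \<in> A. f x \<noteq> \<mu>}"
    using assms(1) by (subst card_Un_disjoint[symmetric]) (auto intro: arg_cong[where f = card])
  then have "even (card {x \<in> A. f x = \<mu>}) \<longleftrightarrow> even (card {x \<in> A. f x \<noteq> \<mu>})"
    using assms(3) by presburger
  moreover have "(\<Sum>x\<in>A. (f x + \<mu>) ^ (q - 1)) = of_nat (card {x \<in> A. f x \<noteq> \<mu>})"
    using sum_power_pred[of A "\<lambda>x. f x + \<mu>"] assms by (auto simp: F_closed image_subset_iff add_eq_0_iff_eq)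
  ultimately show ?thesis by (simp add: of_nat_eq_0_iff_even)
qed

text \<open>All binary digits of q - 1 = 2^m - 1 are 1, so by Lucas every binomial coefficient is
  odd.\<close>

lemma power_pred_add: "(x + y :: 'a) ^ (q - 1) = (\<Sum>k\<le>q-1. x ^ k * y ^ (q - 1 - k))"
proof -
  have "of_nat ((q - 1) choose k) = (1 :: 'a)" if "k \<le> q - 1" for k
    using that q_ge_2 q_eq bin_le_mask[of k m] odd_choose_iff_bin_le[of "q - 1" k]
    by (intro of_nat_odd) auto
  then show ?thesis by (simp add: binomial_ring)
qed

text \<open>As a function of \<mu>, the indicator sum is a polynomial of degree below
  \<open>card F\<close> whose coefficients are the power sums. It vanishes on all of
  \<open>F\<close> only if it is zero.\<close>

lemma even_fibres_iff_power_sums: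
  assumes "finite A" "f ` A \<subseteq> F" "even (card A)"
  shows "(\<forall>\<mu>\<in>F. even (card {x \<in> A. f x = \<mu>})) \<longleftrightarrow> (\<forall>k\<le>q-1. (\<Sum>x\<in>A. f x ^ k) = 0)"
proof -
  define P where "P = (\<Sum>k\<le>q-1. monom (\<Sum>x\<in>A. f x ^ k) (q - 1 - k))"
  have poly_P: "poly P \<mu> = (\<Sum>x\<in>A. (f x + \<mu>) ^ (q - 1))" for \<mu>
  proof -
    have "poly P \<mu> = (\<Sum>k\<le>q-1. \<Sum>x\<in>A. f x ^ k * \<mu> ^ (q - 1 - k))"
      unfolding P_def by (simp add: poly_sum poly_monom sum_distrib_right)
    also have "\<dots> = (\<Sum>x\<in>A. (f x + \<mu>) ^ (q - 1))"
      unfolding power_pred_add by (rule sum.swap)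
    finally show ?thesis .
  qed
  have coeff_P: "coeff P (q - 1 - k) = (\<Sum>x\<in>A. f x ^ k)" if "k \<le> q - 1" for k
  proof -
    have "coeff P (q - 1 - k) = (\<Sum>j\<le>q-1. if j = k then (\<Sum>x\<in>A. f x ^ j) else 0)"
      unfolding P_def coeff_sum using that by (intro sum.cong) auto
    then show ?thesis using that by simp
  qed
  have "degree P \<le> q - 1"
    unfolding P_def by (intro degree_sum_le) (auto intro: degree_monom_le[THEN order_trans])
  then have deg: "degree P < card F" using q_ge_2 card_F by simp
  have "(\<forall>\<mu>\<in>F. even (card {x \<in> A. f x = \<mu>})) \<longleftrightarrow> (\<forall>\<mu>\<in>F. poly P \<mu> = 0)"
    using even_fibre_iff[OF assms] poly_P by simp
  also have "\<dots> \<longleftrightarrow> P = 0"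
    using poly_eqI_degree[of F P 0] deg by auto
  also have "\<dots> \<longleftrightarrow> (\<forall>k\<le>q-1. (\<Sum>x\<in>A. f x ^ k) = 0)"
    using coeff_P by (auto simp: P_def)
  finally show ?thesis .
qed

end

section \<open>Power sums and coefficients\<close>

locale hyperoval_poly = quadratic_extension m q F
  for m q :: nat and F :: "'a::finite_field set" +
  fixes g :: "'a poly"
  assumes g_S: "\<forall>u\<in>unit_circle q. poly g u \<in> F - {0}"
begin

abbreviation H :: "'a set" where "H \<equiv> point_set q g"

lemma H_eq: "H = insert 0 ((\<lambda>u. u / poly g u) ` S)"
  by (auto simp: point_set_def)

text \<open>The norm of u / g(u) is g(u)^(-2), which determines g(u) since squaring is injective,
  and hence u.\<close>

lemma inj_point: "inj_on (\<lambda>u. u / poly g u) S"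
proof (rule inj_onI)
  fix u v assume u: "u \<in> S" and v: "v \<in> S" and eq: "u / poly g u = v / poly g v"
  have norm: "(x / poly g x) ^ (q + 1) = inverse ((poly g x)\<^sup>2)" if "x \<in> S" for x
    using that g_S F_power_q[of "poly g x"]
    by (simp add: S_iff power_mult_distrib power_inverse power2_eq_square divide_inverse)
  have "(poly g u)\<^sup>2 = (poly g v)\<^sup>2" using norm[OF u] norm[OF v] eq by (metis inverse_eq_iff_eq)
  then have "poly g u = poly g v" by (simp add: square_inject)
  then show "u = v" using eq g_S u by auto
qed

lemma zero_not_point: "0 \<notin> (\<lambda>u. u / poly g u) ` S"
  using g_S S_nonzero by auto

lemma card_H: "card H = q + 2"
  unfolding H_eq using zero_not_point card_S by (simp add: card_image[OF inj_point])

lemma bform_point: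
  assumes "u \<in> S"
  shows "bform q w (u / poly g u) = bform q w u / poly g u"
  using assms g_S F_power_q[of "poly g u"]
  by (simp add: bform_eq power_divide add_divide_distrib)

lemma bform_S_eq_0_iff:
  assumes "u \<in> S" "w \<in> S"
  shows "bform q w u = 0 \<longleftrightarrow> u = w"
proof -
  have "bform q u u = 0" using add_self[of "u * u ^ q"] by (simp add: bform_eq mult.commute)
  then show ?thesis using assms ex1_direction[OF S_nonzero[OF assms(1)]] by blast
qed

text \<open>The line with normal \<open>w\<close> through the origin meets \<open>H\<close> in
  exactly 0 and w / g(w), so the top exponent q - 1 imposes no condition.\<close>

lemma power_sum_pred:
  assumes "w \<in> S"
  shows "(\<Sum>x\<in>H. bform q w x ^ (q - 1)) = 0"
proof -
  have "{x \<in> H. bform q w x = 0} = {0, w / poly g w}"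
    unfolding H_eq using assms g_S q_ge_2
    by (auto simp: bform_point bform_S_eq_0_iff) (auto simp: bform_eq)
  moreover have "w / poly g w \<noteq> 0" using assms zero_not_point by force
  ultimately have "even (card {x \<in> H. bform q w x = 0})" by simp
  moreover have "bform q w ` H \<subseteq> F" using bform_in_F by auto
  ultimately show ?thesis
    using even_fibre_iff[of H "bform q w" 0] card_H even_q by (simp add: F_closed)
qed

text \<open>The extreme exponents are automatic: k = 0 gives q + 2 = 0 in K, and k = q - 1 is
  \<open>power_sum_pred\<close>.\<close>

lemma hyperoval_iff_power_sums:
  "hyperoval q F H \<longleftrightarrow> (\<forall>k. 1 \<le> k \<and> k \<le> q - 2 \<longrightarrow> (\<forall>w\<in>S. (\<Sum>x\<in>H. bform q w x ^ k) = 0))"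
proof -
  have "hyperoval q F H \<longleftrightarrow> (\<forall>w\<in>S. \<forall>k\<le>q-1. (\<Sum>x\<in>H. bform q w x ^ k) = 0)"
    unfolding hyperoval_iff_even[OF card_H]
    by (intro ball_cong refl even_fibres_iff_power_sums) (use card_H even_q bform_in_F in auto)
  also have "\<dots> \<longleftrightarrow> (\<forall>k. 1 \<le> k \<and> k \<le> q - 2 \<longrightarrow> (\<forall>w\<in>S. (\<Sum>x\<in>H. bform q w x ^ k) = 0))"
    (is "?L \<longleftrightarrow> ?R")
  proof
    assume ?R
    show ?L
    proof (intro ballI allI impI)
      fix w k assume w: "w \<in> S" and "k \<le> q - 1"
      then consider "k = 0" | "k = q - 1" | "1 \<le> k \<and> k \<le> q - 2" by linarith
      then show "(\<Sum>x\<in>H. bform q w x ^ k) = 0"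
      proof cases
        case 1
        then show ?thesis using card_H even_q of_nat_eq_0_iff_even[of "q + 2"] by simp
      next
        case 2
        then show ?thesis using power_sum_pred[OF w] by simp
      next
        case 3
        then show ?thesis using \<open>?R\<close> w by blast
      qed
    qed
  qed auto
  finally show ?thesis .
qed

text \<open>\<open>char_sum k i\<close> is the paper's \<open>\<Sum>u\<in>S. u\<^sup>2\<^sup>i\<^sup>-\<^sup>k g(u)\<^sup>q\<^sup>-\<^sup>1\<^sup>-\<^sup>k\<close>: the exponent is
  \<open>(k - i)q + i \<equiv> 2i - k\<close> modulo \<open>q + 1\<close>, kept nonnegative.\<close>

definition char_sum :: "nat \<Rightarrow> nat \<Rightarrow> 'a" where
  "char_sum k i = (\<Sum>u\<in>S. u ^ ((k - i) * q + i) * poly g u ^ (q - 1 - k))"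

text \<open>The point 0 contributes nothing as k is positive. Elsewhere g(u) lies in
  \<open>F\<close>, so it factors out of the form as g(u)^(-k) = g(u)^(q-1-k); the rest is binomial
  expansion.\<close>

lemma power_sum_eq:
  assumes k: "1 \<le> k" "k \<le> q - 2" and w: "w \<in> S"
  shows "(\<Sum>x\<in>H. bform q w x ^ k) = (\<Sum>i\<le>k. of_nat (k choose i) * w ^ (i * q + (k - i)) * char_sum k i)"
proof -
  have g: "inverse (poly g u) ^ k = poly g u ^ (q - 1 - k)" if "u \<in> S" for u
  proof -
    have "poly g u ^ k * poly g u ^ (q - 1 - k) = 1"
      using k that g_S F_power_pred[of "poly g u"] by (simp flip: power_add)
    then show ?thesis by (metis inverse_unique power_inverse)
  qed
  have "(\<Sum>x\<in>H. bform q w x ^ k) = (\<Sum>u\<in>S. bform q w (u / poly g u) ^ k)"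
    unfolding H_eq using zero_not_point k q_ge_2
    by (simp add: sum.reindex[OF inj_point] bform_eq)
  also have "\<dots> = (\<Sum>u\<in>S. bform q w u ^ k * poly g u ^ (q - 1 - k))"
  proof (rule sum.cong[OF refl])
    fix u assume u: "u \<in> S"
    show "bform q w (u / poly g u) ^ k = bform q w u ^ k * poly g u ^ (q - 1 - k)"
      unfolding bform_point[OF u] g[OF u, symmetric] by (simp add: divide_inverse power_mult_distrib)
  qed
  also have "\<dots> = (\<Sum>u\<in>S. \<Sum>i\<le>k. of_nat (k choose i) * w ^ (i * q + (k - i)) *
      (u ^ ((k - i) * q + i) * poly g u ^ (q - 1 - k)))"
  proof (rule sum.cong[OF refl])
    fix u
    have "bform q w u ^ k = (\<Sum>i\<le>k. of_nat (k choose i) * (w ^ q * u) ^ i * (w * u ^ q) ^ (k - i))"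
      unfolding bform_eq by (subst add.commute, rule binomial_ring)
    then show "bform q w u ^ k * poly g u ^ (q - 1 - k) =
        (\<Sum>i\<le>k. of_nat (k choose i) * w ^ (i * q + (k - i)) *
          (u ^ ((k - i) * q + i) * poly g u ^ (q - 1 - k)))"
      by (simp only: sum_distrib_right sum_distrib_left power_mult_distrib power_add power_mult[symmetric] mult_ac)
  qed
  also have "\<dots> = (\<Sum>i\<le>k. of_nat (k choose i) * w ^ (i * q + (k - i)) * char_sum k i)"
    unfolding char_sum_def sum_distrib_left by (rule sum.swap)
  finally show ?thesis .
qed

text \<open>Modulo q + 1 one has q = -1, so the exponent is 2(i - j). The modulus is odd, so 2
  cancels, and i - j is too small to be a nonzero multiple.\<close>

lemma exponent_dvd_iff:
  assumes "i \<le> k" "j \<le> k" "k < q"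
  shows "(q + 1) dvd ((k - i) * q + i + (j * q + (k - j))) \<longleftrightarrow> j = i"
proof -
  define d where "d = int j - int i"
  have "int ((k - i) * q + i + (j * q + (k - j))) =
      (int k - int i) * int q + int i + (int j * int q + (int k - int j))"
    using assms by (simp add: of_nat_diff)
  also have "\<dots> = int (q + 1) * (int k + d) - 2 * d"
    unfolding d_def by (simp add: algebra_simps)
  finally have "(q + 1) dvd ((k - i) * q + i + (j * q + (k - j))) \<longleftrightarrow>
      int (q + 1) dvd int (q + 1) * (int k + d) - 2 * d"
    by (metis int_dvd_int_iff)
  also have "\<dots> \<longleftrightarrow> int (q + 1) dvd 2 * d"
    by (metis dvd_diff_right_iff dvd_triv_left)
  also have "\<dots> \<longleftrightarrow> int (q + 1) dvd d"
    using even_q by (intro coprime_dvd_mult_right_iff) (simp add: coprime_right_2_iff_odd)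
  also have "\<dots> \<longleftrightarrow> d = 0"
  proof
    have "\<bar>d\<bar> < int (q + 1)" unfolding d_def using assms by linarith
    then show "int (q + 1) dvd d \<Longrightarrow> d = 0" using dvd_imp_le_int[of d "int (q + 1)"] by linarith
  qed simp
  finally show ?thesis unfolding d_def by auto
qed

text \<open>The power sum is a combination of distinct characters of \<open>w\<close>, so
  orthogonality isolates each coefficient. Lucas decides which binomial factors survive.\<close>

lemma power_sums_vanish_iff:
  assumes k: "1 \<le> k" "k \<le> q - 2"
  shows "(\<forall>w\<in>S. (\<Sum>x\<in>H. bform q w x ^ k) = 0) \<longleftrightarrow> (\<forall>i. i \<preceq> k \<longrightarrow> char_sum k i = 0)"
proof
  assume van: "\<forall>w\<in>S. (\<Sum>x\<in>H. bform q w x ^ k) = 0"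
  show "\<forall>i. i \<preceq> k \<longrightarrow> char_sum k i = 0"
  proof (intro allI impI)
    fix i assume i: "i \<preceq> k"
    then have "i \<le> k" by (rule bin_le_imp_le)
    define c where "c = (\<lambda>j. of_nat (k choose j) * char_sum k j)"
    have "0 = (\<Sum>w\<in>S. w ^ ((k - i) * q + i) * (\<Sum>x\<in>H. bform q w x ^ k))"
      using van by simp
    also have "\<dots> = (\<Sum>w\<in>S. \<Sum>j\<le>k. c j * w ^ ((k - i) * q + i + (j * q + (k - j))))"
      by (intro sum.cong refl) (simp only: power_sum_eq[OF k] c_def sum_distrib_left power_add mult_ac)
    also have "\<dots> = (\<Sum>j\<le>k. c j * (\<Sum>w\<in>S. w ^ ((k - i) * q + i + (j * q + (k - j)))))"
      by (subst sum.swap) (simp add: sum_distrib_left)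
    also have "\<dots> = (\<Sum>j\<le>k. if j = i then c j else 0)"
    proof (intro sum.cong refl)
      fix j assume "j \<in> {..k}"
      then show "c j * (\<Sum>w\<in>S. w ^ ((k - i) * q + i + (j * q + (k - j)))) = (if j = i then c j else 0)"
        using exponent_dvd_iff[of i k j] \<open>i \<le> k\<close> k unfolding sum_S_power by auto
    qed
    also have "\<dots> = c i" using \<open>i \<le> k\<close> by simp
    also have "\<dots> = char_sum k i"
      unfolding c_def using i by (simp add: of_nat_odd odd_choose_iff_bin_le)
    finally show "char_sum k i = 0" by simp
  qed
next
  assume "\<forall>i. i \<preceq> k \<longrightarrow> char_sum k i = 0"
  then have zero: "of_nat (k choose i) * w * char_sum k i = 0" for i w
    by (metis mult_zero_left mult_zero_right odd_choose_iff_bin_le of_nat_eq_0_iff_even)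
  show "\<forall>w\<in>S. (\<Sum>x\<in>H. bform q w x ^ k) = 0"
    by (intro ballI) (simp only: power_sum_eq[OF k] zero sum.neutral_const)
qed

text \<open>Conjugation inverts the elements of \<open>S\<close> and fixes the values of
  \<open>g\<close> there, so u^(2i-k) becomes u^(k-2i).\<close>

lemma char_sum_conj:
  assumes "i \<le> k"
  shows "char_sum k (k - i) = char_sum k i ^ q"
  unfolding char_sum_def sum_power_q
proof (rule sum.cong[OF refl])
  fix u assume u: "u \<in> S"
  have gq: "(poly g u ^ (q - 1 - k)) ^ q = poly g u ^ (q - 1 - k)"
    using u g_S F_power_q[of "poly g u"] by (simp add: power_commutes flip: power_mult)
      (metis mult.commute power_mult)
  have "(q + 1) dvd ((k - i) * q + i + ((k - i) * q + i) * q)"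
    by (metis dvd_triv_left mult.commute mult_Suc_right Suc_eq_plus1)
  moreover have "(k - i) * q + i + (i * q + (k - i)) = (q + 1) * k"
    using assms by (auto simp: algebra_simps le_iff_add)
  \<comment> \<open>Both factors complete the same power of u to a multiple of q + 1, hence agree
    after cancelling; all exponents stay nonnegative.\<close>
  ultimately have "u ^ ((k - i) * q + i) * u ^ (((k - i) * q + i) * q) =
      u ^ ((k - i) * q + i) * u ^ (i * q + (k - i))"
    using S_power_multiple[OF u] by (metis dvd_triv_left power_add)
  then have "(u ^ ((k - i) * q + i)) ^ q = u ^ (i * q + (k - i))"
    using S_nonzero[OF u] by (simp add: power_mult)
  then show "u ^ ((k - (k - i)) * q + (k - i)) * poly g u ^ (q - 1 - k) =
      (u ^ ((k - i) * q + i) * poly g u ^ (q - 1 - k)) ^ q"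
    using gq assms by (simp add: power_mult_distrib)
qed

lemma char_sum_conj_eq_0_iff: "i \<le> k \<Longrightarrow> char_sum k (k - i) = 0 \<longleftrightarrow> char_sum k i = 0"
  using q_ge_2 by (simp add: char_sum_conj)

text \<open>Fourier inversion on \<open>S\<close>: the remainder agrees with g^n on
  \<open>S\<close>, and orthogonality selects the one position in 0..q congruent to -e modulo q +
  1.\<close>

lemma coeff_reduced_power:
  assumes "j \<le> q" "(q + 1) dvd (e + j)"
  shows "coeff (reduced_power q g n) j = (\<Sum>u\<in>S. u ^ e * poly g u ^ n)"
proof -
  define M where "M = monom (1 :: 'a) (q + 1) - 1"
  define r where "r = g ^ n mod M"
  have deg_M: "degree M = q + 1"
    unfolding M_def using degree_add_eq_left[of "-1" "monom (1 :: 'a) (q + 1)"]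
    by (simp add: degree_monom_eq)
  then have "M \<noteq> 0" by auto
  then have deg_r: "degree r \<le> q"
    using degree_mod_less[of M "g ^ n"] deg_M unfolding r_def by auto
  have eval: "poly r u = poly g u ^ n" if "u \<in> S" for u
  proof -
    have "poly M u = 0" using that unfolding M_def by (simp add: poly_monom S_iff)
    moreover have "g ^ n = M * (g ^ n div M) + r" unfolding r_def by simp
    ultimately show ?thesis by (metis add_0 mult_zero_left poly_add poly_mult poly_power)
  qed
  have not_both: False if "a < b" "b \<le> q" "(q + 1) dvd (e + a)" "(q + 1) dvd (e + b)" for a b
    using dvd_diff_nat[OF that(4,3)] that by (auto dest: dvd_imp_le)
  have dvd: "(q + 1) dvd (e + l) \<longleftrightarrow> l = j" if "l \<le> q" for l
  proof
    assume "(q + 1) dvd (e + l)"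
    then show "l = j"
      using not_both[of l j] not_both[of j l] assms that by (meson linorder_neqE_nat)
  qed (use assms in simp)
  have "(\<Sum>u\<in>S. u ^ e * poly g u ^ n) = (\<Sum>u\<in>S. u ^ e * (\<Sum>l\<le>q. coeff r l * u ^ l))"
  proof (rule sum.cong[OF refl])
    fix u assume "u \<in> S"
    have "poly r u = (\<Sum>l\<le>q. coeff r l * u ^ l)"
      unfolding poly_altdef using deg_r by (intro sum.mono_neutral_left) (auto simp: coeff_eq_0)
    then show "u ^ e * poly g u ^ n = u ^ e * (\<Sum>l\<le>q. coeff r l * u ^ l)"
      using eval[OF \<open>u \<in> S\<close>] by simp
  qed
  also have "\<dots> = (\<Sum>u\<in>S. \<Sum>l\<le>q. coeff r l * u ^ (e + l))"
    by (simp add: sum_distrib_left power_add mult_ac)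
  also have "\<dots> = (\<Sum>l\<le>q. coeff r l * (\<Sum>u\<in>S. u ^ (e + l)))"
    by (subst sum.swap) (simp add: sum_distrib_left)
  also have "\<dots> = (\<Sum>l\<le>q. if l = j then coeff r l else 0)"
    by (intro sum.cong refl) (use dvd in \<open>auto simp: sum_S_power simp del: Suc_eq_plus1\<close>)
  also have "\<dots> = coeff r j" using assms(1) by simp
  finally show ?thesis unfolding r_def M_def reduced_power_def by simp
qed

lemma coeff_eq_char_sum:
  assumes "(i, k) \<in> index_set q"
  shows "coeff (reduced_power q g (q - 1 - k)) (k - 2 * i) = char_sum k i"
    and "coeff (reduced_power q g (q - 1 - k)) (2 * i + q + 1 - k) = char_sum k (k - i)"
proof -
  \<comment> \<open>For positive k, i <= (k - 1) div 2 means 2i < k. This puts both coefficient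
    positions in the range 0..q and makes the truncated subtractions exact.\<close>
  have k: "k \<le> q - 2" "2 * i < k" using assms unfolding index_set_def by auto
  have "i + (k - 2 * i) = k - i" using k by linarith
  then have "(k - i) * q + i + (k - 2 * i) = (q + 1) * (k - i)"
    by (simp only: add.assoc distrib_right mult_1 mult.commute[of q])
  then have "(q + 1) dvd ((k - i) * q + i + (k - 2 * i))" by (simp only: dvd_triv_left)
  then show "coeff (reduced_power q g (q - 1 - k)) (k - 2 * i) = char_sum k i"
    unfolding char_sum_def using k by (intro coeff_reduced_power) auto
  have "k - (k - i) = i" "(k - i) + (2 * i + q + 1 - k) = i + q + 1" using k by linarith+
  then have "(k - (k - i)) * q + (k - i) + (2 * i + q + 1 - k) = (q + 1) * (i + 1)"
    by (simp add: add.assoc)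
  then have "(q + 1) dvd ((k - (k - i)) * q + (k - i) + (2 * i + q + 1 - k))" by (simp only: dvd_triv_left)
  then show "coeff (reduced_power q g (q - 1 - k)) (2 * i + q + 1 - k) = char_sum k (k - i)"
    unfolding char_sum_def using k by (intro coeff_reduced_power) auto
qed

text \<open>The reflection sending i to k - i preserves \<open>i \<preceq> k\<close> and the
  vanishing of the sums, and has no fixed point for positive k. So one of i and k - i lies below
  k/2.\<close>

lemma char_sums_vanish_iff:
  "(\<forall>k. 1 \<le> k \<and> k \<le> q - 2 \<longrightarrow> (\<forall>i. i \<preceq> k \<longrightarrow> char_sum k i = 0)) \<longleftrightarrow>
    (\<forall>(i, k)\<in>index_set q. char_sum k i = 0)"
proof
  assume van: "\<forall>(i, k)\<in>index_set q. char_sum k i = 0"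
  show "\<forall>k. 1 \<le> k \<and> k \<le> q - 2 \<longrightarrow> (\<forall>i. i \<preceq> k \<longrightarrow> char_sum k i = 0)"
  proof (intro allI impI, elim conjE)
    fix i k assume k: "1 \<le> k" "k \<le> q - 2" and i: "i \<preceq> k"
    then have "i \<le> k" by (simp add: bin_le_imp_le)
    have "2 * i \<noteq> k" using not_bin_le_double[of i] i k by auto
    then consider "2 * i < k" | "2 * (k - i) < k" using \<open>i \<le> k\<close> by linarith
    then show "char_sum k i = 0"
    proof cases
      case 1
      then have "(i, k) \<in> index_set q" using k i unfolding index_set_def by auto
      then show ?thesis using van by auto
    next
      case 2
      then have "(k - i, k) \<in> index_set q" using k bin_le_diff[OF i] unfolding index_set_def by auto
      then show ?thesis using van char_sum_conj_eq_0_iff[OF \<open>i \<le> k\<close>] by auto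
    qed
  qed
qed (auto simp: index_set_def)

end

theorem theorem5p3:
  fixes m q :: nat
    and F :: "'a::finite_field set"
    and g :: "'a poly"
  assumes "q = 2 ^ m"
    and "CARD('a) = q ^ 2"
    and "is_subfield F" and "card F = q"
    and "\<forall>u\<in>unit_circle q. poly g u \<in> F - {0}"
  shows "(hyperoval q F (point_set q g) \<longleftrightarrow>
            (\<forall>(i, k)\<in>index_set q. coeff (reduced_power q g (q - 1 - k)) (2 * i + q + 1 - k) = 0))
       \<and> ((\<forall>(i, k)\<in>index_set q. coeff (reduced_power q g (q - 1 - k)) (2 * i + q + 1 - k) = 0) \<longleftrightarrow>
            (\<forall>(i, k)\<in>index_set q. coeff (reduced_power q g (q - 1 - k)) (k - 2 * i) = 0))"
proof -
  interpret hyperoval_poly m q F g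
    using assms by unfold_locales
  \<comment> \<open>Condition (b) sees the conjugates of the sums that condition (c) sees
    directly.\<close>
  have b: "(\<forall>(i, k)\<in>index_set q. coeff (reduced_power q g (q - 1 - k)) (2 * i + q + 1 - k) = 0) \<longleftrightarrow>
      (\<forall>(i, k)\<in>index_set q. char_sum k i = 0)"
  proof (intro ball_cong refl, clarify)
    fix i k assume ik: "(i, k) \<in> index_set q"
    then have "i \<le> k" by (auto simp: index_set_def bin_le_imp_le)
    then show "coeff (reduced_power q g (q - 1 - k)) (2 * i + q + 1 - k) = 0 \<longleftrightarrow> char_sum k i = 0"
      using coeff_eq_char_sum(2)[OF ik] char_sum_conj_eq_0_iff by simp
  qed
  have c: "(\<forall>(i, k)\<in>index_set q. coeff (reduced_power q g (q - 1 - k)) (k - 2 * i) = 0) \<longleftrightarrow>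
      (\<forall>(i, k)\<in>index_set q. char_sum k i = 0)"
    using coeff_eq_char_sum(1) by (intro ball_cong refl) auto
  have "hyperoval q F (point_set q g) \<longleftrightarrow> (\<forall>(i, k)\<in>index_set q. char_sum k i = 0)"
    unfolding hyperoval_iff_power_sums char_sums_vanish_iff[symmetric]
    using power_sums_vanish_iff by blast
  then show ?thesis using b c by simp
qed

end
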